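(* C-MP-AMP (column-wise multiprocessor approximate message passing) converges to a fixed point that is no worse than that of AMP (approximate message passing). More precisely, the average asymptotic performance of C-MP-AMP at convergence, as characterized by its state evolution, is identical to that of AMP when there is only one solution $\tau$ to the AMP fixed point equation $$\tau^2=\sigma_W^2+\delta^{-1}\mathbb{E}\left[\left(\eta(X+\tau Z)-X\right)^2\right],$$ and it is at least as good as that of AMP in case this equation has multiple solutions (multiple fixed points).
   Context: Problem: estimate $x\in\mathbb{R}^N$ from $y=Ax+w=\sum_{p=1}^P A_px_p+w\in\mathbb{R}^n$, where the columns of $A$ are split among $P$ processors ($P$ fixed), $A_p\in\mathbb{R}^{n\times N_p}$, $\sum_{p=1}^P N_p=N$, $\delta_p=n/N_p\in(0,\infty)$ constant, $\delta=n/N$, so that $\sum_{p=1}^P\delta_p^{-1}=\delta^{-1}$. The signal has entries distributed as $X\sim p_X$, $\sigma_W^2$ is the noise variance, $Z\sim\mathcal{N}(0,1)$ is independent of $X$, and the denoisers $\eta_t,\eta_{s,k}:\mathbb{R}\to\mathbb{R}$ are Lipschitz with weak derivatives $\eta_t',\eta_{s,k}'$ and act coordinate-wise on vectors. $A^*$ denotes the transpose of $A$. AMP: $x^0=0$, $z^t=y-Ax^t+\frac{z^{t-1}}{n}\sum_{i=1}^N\eta_{t-1}'([x^{t-1}+A^*z^{t-1}]_i)$, $x^{t+1}=\eta_t(x^t+A^*z^t)$, with vectors of negative iteration index equal to zero. Its asymptotic dynamics are described by the state evolution $(\sigma^0)^2=\delta^{-1}\mathbb{E}[X^2]$, $(\tau^t)^2=\sigma_W^2+(\sigma^t)^2$,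 $(\sigma^{t+1})^2=\delta^{-1}\mathbb{E}[(\eta_t(X+\tau^tZ)-X)^2]$. C-MP-AMP: initialize $x_p^{0,\hat k_0}=0$, $r_p^{0,\hat k_0}=0$. For outer iterations $s=1,2,\dots$, a fusion center computes $g^s=\sum_{u=1}^P r_u^{s-1,\hat k_{s-1}}$; each processor $p$ sets $x_p^{s,0}=x_p^{s-1,\hat k_{s-1}}$, $r_p^{s,0}=r_p^{s-1,\hat k_{s-1}}$ and, for inner iterations $k=0,\dots,\hat k_s-1$, computes $z_p^{s,k}=y-g^s-(r_p^{s,k}-r_p^{s,0})$, $x_p^{s,k+1}=\eta_{s,k}(x_p^{s,k}+A_p^*z_p^{s,k})$, $r_p^{s,k+1}=A_px_p^{s,k+1}-\frac{z_p^{s,k}}{n}\sum_{i=1}^{N_p}\eta_{s,k}'([x_p^{s,k}+A_p^*z_p^{s,k}]_i)$. Its asymptotic dynamics are described by the state evolution $(\sigma_p^{0,\hat k_0})^2=\delta_p^{-1}\mathbb{E}[X^2]$, $(\sigma_p^{s,0})^2=(\sigma_p^{s-1,\hat k_{s-1}})^2$, $(\tau_p^{s,k})^2=\sigma_W^2+\sum_{u\ne p}(\sigma_u^{s,0})^2+(\sigma_p^{s,k})^2$, $(\sigma_p^{s,k+1})^2=\delta_p^{-1}\mathbb{E}[(\eta_{s,k}(X+\tau_p^{s,k}Z)-X)^2]$. At convergence the state evolution quantities no longer change, so iteration indices are dropped (and the denoiser is written $\eta$). The justification given is that at convergence of C-MP-AMP all $(\tau_p^{s,k})^2$ equal a common value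 $\tau^2$ satisfying the AMP fixed point equation displayed in the claim, and that AMP always converges to the worst fixed point of that equation (a fact taken from the earlier literature). *)

theory Defs
  imports "HOL-Probability.Probability"
begin

text \<open>
  State evolution of AMP and of C-MP-AMP. The signal prior and the standard normal variable are
  given as random variables \<open>X\<close>, \<open>Z\<close> on a probability space \<open>M\<close>; \<open>sW\<close> is the noise standard
  deviation. The recursions are on the squared quantities \<open>\<sigma>\<^sup>2\<close>; the \<open>\<tau>\<close>'s are the
  nonnegative square roots. Processors are numbered \<open>1..P\<close>.
\<close>

definition mse :: "'a measure \<Rightarrow> ('a \<Rightarrow> real) \<Rightarrow> ('a \<Rightarrow> real) \<Rightarrow> (real \<Rightarrow> real) \<Rightarrow> real \<Rightarrow> real" where
  "mse M X Z \<eta> \<tau> = (\<integral>\<omega>. (\<eta> (X \<omega> + \<tau> * Z \<omega>) - X \<omega>)\<^sup>2 \<partial>M)"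

context
  fixes M :: "'a measure" and X Z :: "'a \<Rightarrow> real" and sW :: real
begin

fun amp_sigma2 :: "real \<Rightarrow> (nat \<Rightarrow> real \<Rightarrow> real) \<Rightarrow> nat \<Rightarrow> real" where
  "amp_sigma2 \<delta> \<eta> 0 = 1 / \<delta> * (\<integral>\<omega>. (X \<omega>)\<^sup>2 \<partial>M)"
| "amp_sigma2 \<delta> \<eta> (Suc t) = 1 / \<delta> * mse M X Z (\<eta> t) (sqrt (sW\<^sup>2 + amp_sigma2 \<delta> \<eta> t))"

definition amp_tau :: "real \<Rightarrow> (nat \<Rightarrow> real \<Rightarrow> real) \<Rightarrow> nat \<Rightarrow> real" where
  "amp_tau \<delta> \<eta> t = sqrt (sW\<^sup>2 + amp_sigma2 \<delta> \<eta> t)"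

text \<open>Asymptotic mean square error of the AMP estimate \<open>x\<close> with index \<open>t + 1\<close>.\<close>

definition amp_mse :: "real \<Rightarrow> (nat \<Rightarrow> real \<Rightarrow> real) \<Rightarrow> nat \<Rightarrow> real" where
  "amp_mse \<delta> \<eta> t = mse M X Z (\<eta> t) (amp_tau \<delta> \<eta> t)"

text \<open>Only \<open>\<tau> \<ge> 0\<close> counts as a solution: \<open>\<tau>\<close> is a standard deviation, and as \<open>Z\<close> is symmetric,
  \<open>- \<tau>\<close> would always satisfy the equation together with \<open>\<tau>\<close>.\<close>

definition amp_fixed_point :: "real \<Rightarrow> (real \<Rightarrow> real) \<Rightarrow> real \<Rightarrow> bool" where
  "amp_fixed_point \<delta> \<eta> \<tau> \<longleftrightarrow> 0 \<le> \<tau> \<and> \<tau>\<^sup>2 = sW\<^sup>2 + 1 / \<delta> * mse M X Z \<eta> \<tau>"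

text \<open>
  In \<open>cmp_sigma2 P \<delta>p kh \<eta> p s k\<close>, \<open>p\<close> is the processor, \<open>s\<close> the outer and \<open>k\<close> the inner iteration;
  \<open>kh s\<close> is the number of inner iterations in outer iteration \<open>s\<close>. Row \<open>s = 0\<close> is the
  initialization (the value at \<open>k = kh 0\<close> is the only one used). For \<open>s > 0\<close> only indices
  \<open>k \<le> kh s\<close> are meaningful.
\<close>

fun cmp_sigma2 :: "nat \<Rightarrow> (nat \<Rightarrow> real) \<Rightarrow> (nat \<Rightarrow> nat) \<Rightarrow> (nat \<Rightarrow> nat \<Rightarrow> real \<Rightarrow> real)
    \<Rightarrow> nat \<Rightarrow> nat \<Rightarrow> nat \<Rightarrow> real" where
  "cmp_sigma2 P \<delta>p kh \<eta> p 0 k = 1 / \<delta>p p * (\<integral>\<omega>. (X \<omega>)\<^sup>2 \<partial>M)"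
| "cmp_sigma2 P \<delta>p kh \<eta> p (Suc s) 0 = cmp_sigma2 P \<delta>p kh \<eta> p s (kh s)"
| "cmp_sigma2 P \<delta>p kh \<eta> p (Suc s) (Suc k) =
     1 / \<delta>p p * mse M X Z (\<eta> (Suc s) k)
       (sqrt (sW\<^sup>2 + (\<Sum>u\<in>{1..P} - {p}. cmp_sigma2 P \<delta>p kh \<eta> u (Suc s) 0)
              + cmp_sigma2 P \<delta>p kh \<eta> p (Suc s) k))"

definition cmp_tau :: "nat \<Rightarrow> (nat \<Rightarrow> real) \<Rightarrow> (nat \<Rightarrow> nat) \<Rightarrow> (nat \<Rightarrow> nat \<Rightarrow> real \<Rightarrow> real)
    \<Rightarrow> nat \<Rightarrow> nat \<Rightarrow> nat \<Rightarrow> real" where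
  "cmp_tau P \<delta>p kh \<eta> p s k =
     sqrt (sW\<^sup>2 + (\<Sum>u\<in>{1..P} - {p}. cmp_sigma2 P \<delta>p kh \<eta> u s 0) + cmp_sigma2 P \<delta>p kh \<eta> p s k)"

text \<open>Asymptotic mean square error of processor \<open>p\<close>'s estimate with index \<open>(s, k + 1)\<close>.\<close>

definition cmp_mse :: "nat \<Rightarrow> (nat \<Rightarrow> real) \<Rightarrow> (nat \<Rightarrow> nat) \<Rightarrow> (nat \<Rightarrow> nat \<Rightarrow> real \<Rightarrow> real)
    \<Rightarrow> nat \<Rightarrow> nat \<Rightarrow> nat \<Rightarrow> real" where
  "cmp_mse P \<delta>p kh \<eta> p s k = mse M X Z (\<eta> s k) (cmp_tau P \<delta>p kh \<eta> p s k)"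

text \<open>Average over all \<open>N\<close> signal entries: processor \<open>p\<close> holds the fraction
  \<open>N\<^sub>p / N = \<delta> / \<delta>\<^sub>p\<close> of them, where \<open>\<delta>\<^sub>p = n / N\<^sub>p\<close> and \<open>\<delta> = n / N\<close>.\<close>

definition cmp_avg_mse :: "real \<Rightarrow> nat \<Rightarrow> (nat \<Rightarrow> real) \<Rightarrow> (nat \<Rightarrow> nat)
    \<Rightarrow> (nat \<Rightarrow> nat \<Rightarrow> real \<Rightarrow> real) \<Rightarrow> nat \<Rightarrow> nat \<Rightarrow> real" where
  "cmp_avg_mse \<delta> P \<delta>p kh \<eta> s k = (\<Sum>p=1..P. \<delta> / \<delta>p p * cmp_mse P \<delta>p kh \<eta> p s k)"

end

text \<open>
  Convergence of a family indexed by outer and inner iterations: as \<open>s\<close> tends to infinity, all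
  members with inner index \<open>k \<in> K s\<close> approach \<open>l\<close>, so neither outer nor inner iterations
  change the value in the limit.
\<close>

definition iter_tendsto :: "(nat \<Rightarrow> nat set) \<Rightarrow> (nat \<Rightarrow> nat \<Rightarrow> real) \<Rightarrow> real \<Rightarrow> bool" where
  "iter_tendsto K a l \<longleftrightarrow> (\<forall>e>0. \<forall>\<^sub>F s in sequentially. \<forall>k\<in>K s. \<bar>a s k - l\<bar> < e)"

end

theory Submission
  imports Defs
begin

text \<open>
  Dominated convergence makes the mean square error jointly continuous in the noise level and,
  along pointwise convergent uniformly Lipschitz denoisers, in the denoiser. Hence the limits of
  both state evolutions are fixed points of their limiting recursions. For C-MP-AMP the limiting
  \<open>\<tau>\<^sub>p\<close> is the same for every processor \<open>p\<close>, and summing the limiting equations over \<open>p\<close>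
  turns the weights \<open>1 / \<delta>\<^sub>p\<close> into \<open>1 / \<delta>\<close>: it is a fixed point of the AMP equation too.
\<close>

text \<open>Fixing one inner index \<open>k s\<close> per row makes the usual calculus of sequence
  limits available. Only rows \<open>1 \<le> s\<close> constrain the choice, because
  \<open>K 0\<close> may be empty, as \<open>{..<kh 0}\<close> is when
  \<open>kh 0 = 0\<close>.\<close>

lemma iter_tendstoD:
  assumes "iter_tendsto K a l" and "\<And>s. 1 \<le> s \<Longrightarrow> k s \<in> K s"
  shows "(\<lambda>s. a s (k s)) \<longlonglongrightarrow> l"
proof (rule tendstoI)
  fix e :: real
  assume "0 < e"
  then have "\<forall>\<^sub>F s in sequentially. \<forall>j\<in>K s. \<bar>a s j - l\<bar> < e"
    using assms(1) by (auto simp: iter_tendsto_def)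
  with eventually_ge_at_top[of 1] show "\<forall>\<^sub>F s in sequentially. dist (a s (k s)) l < e"
    by eventually_elim (use assms(2) in \<open>auto simp: dist_real_def\<close>)
qed

text \<open>If uniformity failed for some \<open>e\<close>, infinitely many rows would contain a
  violating index, and selecting these would give a sequence that does not tend to \<open>l\<close>.
  Non-emptiness of \<open>K s\<close> supplies a choice in the other rows from 1 on.\<close>

lemma iter_tendstoI:
  assumes nonempty: "\<And>s. 1 \<le> s \<Longrightarrow> K s \<noteq> {}"
    and lim: "\<And>k. (\<And>s. 1 \<le> s \<Longrightarrow> k s \<in> K s) \<Longrightarrow> (\<lambda>s. a s (k s)) \<longlonglongrightarrow> l"
  shows "iter_tendsto K a l"
  unfolding iter_tendsto_def
proof (intro allI impI)
  fix e :: real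
  assume e: "0 < e"
  \<comment> \<open>A selection that violates the bound \<open>e\<close> whenever some index does.\<close>
  define k where "k s = (if \<exists>j\<in>K s. \<not> \<bar>a s j - l\<bar> < e
    then SOME j. j \<in> K s \<and> \<not> \<bar>a s j - l\<bar> < e else SOME j. j \<in> K s)" for s
  have bad: "k s \<in> K s \<and> \<not> \<bar>a s (k s) - l\<bar> < e" if "\<exists>j\<in>K s. \<not> \<bar>a s j - l\<bar> < e" for s
    using that someI_ex[of "\<lambda>j. j \<in> K s \<and> \<not> \<bar>a s j - l\<bar> < e"] by (auto simp: k_def)
  have "k s \<in> K s" if "1 \<le> s" for s
  proof (cases "\<exists>j\<in>K s. \<not> \<bar>a s j - l\<bar> < e")
    case True
    then show ?thesis using bad by blast
  next
    case False
    then show ?thesis using nonempty[OF that] by (simp add: k_def some_in_eq)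
  qed
  then have "\<forall>\<^sub>F s in sequentially. dist (a s (k s)) l < e"
    using lim e tendstoD by blast
  then show "\<forall>\<^sub>F s in sequentially. \<forall>j\<in>K s. \<bar>a s j - l\<bar> < e"
    by eventually_elim (use bad in \<open>auto simp: dist_real_def\<close>)
qed

lemma mse_nonneg: "0 \<le> mse M X Z f \<tau>"
  by (simp add: mse_def)

lemma square_sum3_le: "(a + b + c)\<^sup>2 \<le> 3 * (a\<^sup>2 + b\<^sup>2 + c\<^sup>2)" for a b c :: real
proof -
  have "0 \<le> (a - b)\<^sup>2 + (b - c)\<^sup>2 + (a - c)\<^sup>2" by simp
  then show ?thesis by (simp add: power2_eq_square algebra_simps)
qed

lemma integrable_std_normal_square:
  assumes "distributed M lborel Z std_normal_density"
  shows "integrable M (\<lambda>\<omega>. (Z \<omega>)\<^sup>2)"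
  using integrable_std_normal_moment[of 2] distributed_integrable[OF assms, of "\<lambda>x. x\<^sup>2"]
  by simp

text \<open>The shared constant \<open>L\<close> does double duty: it lets denoiser and argument
  converge simultaneously, and with a bound on \<open>f n 0\<close> it limits all \<open>f n\<close>
  to one affine growth rate, so a single majorant quadratic in \<open>X\<close> and \<open>Z\<close>
  serves every \<open>n\<close>.\<close>

lemma tendsto_mse:
  fixes X Z :: "'a \<Rightarrow> real" and f :: "nat \<Rightarrow> real \<Rightarrow> real"
  assumes M: "prob_space M"
    and X[measurable]: "X \<in> borel_measurable M" and Z[measurable]: "Z \<in> borel_measurable M"
    and X2: "integrable M (\<lambda>\<omega>. (X \<omega>)\<^sup>2)" and Z2: "integrable M (\<lambda>\<omega>. (Z \<omega>)\<^sup>2)"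
    and lip: "\<And>n. L-lipschitz_on UNIV (f n)"
    and lim: "\<And>x. (\<lambda>n. f n x) \<longlonglongrightarrow> g x"
    and t: "t \<longlonglongrightarrow> \<tau>"
  shows "(\<lambda>n. mse M X Z (f n) (t n)) \<longlonglongrightarrow> mse M X Z g \<tau>"
proof -
  interpret prob_space M by fact
  have L: "0 \<le> L" using lip lipschitz_on_nonneg by blast
  have f_diff: "\<bar>f n x - f n y\<bar> \<le> L * \<bar>x - y\<bar>" for n x y
    using lipschitz_onD[OF lip, of x y n] by (simp add: dist_real_def)
  \<comment> \<open>The bound survives the pointwise limit, which makes \<open>g\<close> continuous
    and hence measurable.\<close>
  have g_diff: "\<bar>g x - g y\<bar> \<le> L * \<bar>x - y\<bar>" for x y
    by (rule LIMSEQ_le_const2[OF tendsto_rabs[OF tendsto_diff[OF lim lim]]])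
      (use f_diff in blast)
  have g_lip: "L-lipschitz_on UNIV g"
    by (rule lipschitz_onI) (use g_diff L in \<open>auto simp: dist_real_def\<close>)
  have f_meas[measurable]: "f n \<in> borel_measurable borel" for n
    using lip lipschitz_on_continuous_on borel_measurable_continuous_onI by blast
  have g_meas[measurable]: "g \<in> borel_measurable borel"
    using g_lip lipschitz_on_continuous_on borel_measurable_continuous_onI by blast
  obtain C where C: "\<And>n. \<bar>f n 0\<bar> \<le> C"
    using convergent_imp_Bseq[OF convergentI[OF lim[of 0]]] by (auto simp: Bseq_def)
  obtain T where T: "0 < T" "\<And>n. \<bar>t n\<bar> \<le> T"
    using convergent_imp_Bseq[OF convergentI[OF t]] by (auto simp: Bseq_def)
  \<comment> \<open>Function and argument both vary with \<open>n\<close>. Moving the argument to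
    its limit costs at most \<open>L\<close> times the displacement, uniformly in \<open>n\<close>;
    what remains is pointwise convergence at a fixed point.\<close>
  have conv: "(\<lambda>n. f n (x + t n * z)) \<longlonglongrightarrow> g (x + \<tau> * z)" for x z
  proof -
    have "(\<lambda>n. L * \<bar>(x + t n * z) - (x + \<tau> * z)\<bar>) \<longlonglongrightarrow> L * \<bar>(x + \<tau> * z) - (x + \<tau> * z)\<bar>"
      by (intro tendsto_intros t)
    then have "(\<lambda>n. L * \<bar>(x + t n * z) - (x + \<tau> * z)\<bar>) \<longlonglongrightarrow> 0"
      by simp
    then have "(\<lambda>n. f n (x + t n * z) - f n (x + \<tau> * z)) \<longlonglongrightarrow> 0"
      by (rule Lim_null_comparison[rotated]) (simp only: real_norm_def f_diff eventually_True)
    from tendsto_add[OF this lim[of "x + \<tau> * z"]] show ?thesis by simp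
  qed
  \<comment> \<open>Bounds the square of \<open>C + (L + 1) * \<bar>X \<omega>\<bar> + L * T *
    \<bar>Z \<omega>\<bar>\<close> through \<open>square_sum3_le\<close>; the \<open>+ 1\<close>
    pays for subtracting \<open>X \<omega>\<close>.\<close>
  define w where
    "w \<omega> = 3 * (C\<^sup>2 + (L + 1)\<^sup>2 * (X \<omega>)\<^sup>2 + (L * T)\<^sup>2 * (Z \<omega>)\<^sup>2)" for \<omega>
  have bound: "(f n (X \<omega> + t n * Z \<omega>) - X \<omega>)\<^sup>2 \<le> w \<omega>" for n \<omega>
  proof -
    have "\<bar>f n (X \<omega> + t n * Z \<omega>) - f n 0\<bar> \<le> L * \<bar>X \<omega> + t n * Z \<omega>\<bar>"
      using f_diff[of n "X \<omega> + t n * Z \<omega>" 0] by simp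
    also have "\<dots> \<le> L * (\<bar>X \<omega>\<bar> + T * \<bar>Z \<omega>\<bar>)"
    proof (rule mult_left_mono[OF _ L])
      have "\<bar>t n * Z \<omega>\<bar> \<le> T * \<bar>Z \<omega>\<bar>"
        unfolding abs_mult by (intro mult_right_mono T) simp
      then show "\<bar>X \<omega> + t n * Z \<omega>\<bar> \<le> \<bar>X \<omega>\<bar> + T * \<bar>Z \<omega>\<bar>" by linarith
    qed
    finally have "\<bar>f n (X \<omega> + t n * Z \<omega>) - X \<omega>\<bar> \<le> C + (L + 1) * \<bar>X \<omega>\<bar> + L * T * \<bar>Z \<omega>\<bar>"
      using C[of n] by (simp add: algebra_simps)
    then have "(f n (X \<omega> + t n * Z \<omega>) - X \<omega>)\<^sup>2 \<le> (C + (L + 1) * \<bar>X \<omega>\<bar> + L * T * \<bar>Z \<omega>\<bar>)\<^sup>2"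
      by (metis abs_ge_zero power2_abs power_mono)
    also have "\<dots> \<le> w \<omega>"
      using square_sum3_le[of C "(L + 1) * \<bar>X \<omega>\<bar>" "L * T * \<bar>Z \<omega>\<bar>"]
      by (simp add: w_def power_mult_distrib)
    finally show ?thesis .
  qed
  show ?thesis
    unfolding mse_def
  proof (rule integral_dominated_convergence[where w = w])
    show "integrable M w" unfolding w_def using X2 Z2 by simp
    show "AE \<omega> in M. (\<lambda>n. (f n (X \<omega> + t n * Z \<omega>) - X \<omega>)\<^sup>2)
        \<longlonglongrightarrow> (g (X \<omega> + \<tau> * Z \<omega>) - X \<omega>)\<^sup>2"
      by (intro always_eventually allI tendsto_intros conv)
    show "AE \<omega> in M. norm ((f n (X \<omega> + t n * Z \<omega>) - X \<omega>)\<^sup>2) \<le> w \<omega>" for n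
      using bound by (intro always_eventually) simp
  qed measurable
qed

theorem mainTheorem2:
  fixes M :: "'a measure" and X Z :: "'a \<Rightarrow> real" and sW :: real
    and P :: nat and \<delta>p :: "nat \<Rightarrow> real" and \<delta> :: real
    and kh :: "nat \<Rightarrow> nat"
    and \<eta>A :: "nat \<Rightarrow> real \<Rightarrow> real" and \<eta>C :: "nat \<Rightarrow> nat \<Rightarrow> real \<Rightarrow> real"
    and \<eta> :: "real \<Rightarrow> real" and L :: real
    and sigC :: "nat \<Rightarrow> real" and tauA :: real
  assumes M: "prob_space M"
    and indep: "prob_space.indep_var M borel X borel Z"
    and X2: "integrable M (\<lambda>\<omega>. (X \<omega>)\<^sup>2)"
    and Z: "distributed M lborel Z std_normal_density"
    and P: "1 \<le> P"
    and \<delta>p: "\<And>p. p \<in> {1..P} \<Longrightarrow> 0 < \<delta>p p"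
    and \<delta>: "(\<Sum>p=1..P. 1 / \<delta>p p) = 1 / \<delta>"
    and kh: "\<And>s. 1 \<le> s \<Longrightarrow> 1 \<le> kh s"
    and lipA: "\<And>t. L-lipschitz_on UNIV (\<eta>A t)"
    and lipC: "\<And>s k. 1 \<le> s \<Longrightarrow> k < kh s \<Longrightarrow> L-lipschitz_on UNIV (\<eta>C s k)"
    and limA: "\<And>x. (\<lambda>t. \<eta>A t x) \<longlonglongrightarrow> \<eta> x"
    and limC: "\<And>x. iter_tendsto (\<lambda>s. {..<kh s}) (\<lambda>s k. \<eta>C s k x) (\<eta> x)"
    and convC: "\<And>p. p \<in> {1..P} \<Longrightarrow>
      iter_tendsto (\<lambda>s. {..kh s}) (cmp_sigma2 M X Z sW P \<delta>p kh \<eta>C p) (sigC p)"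
    and convA: "amp_tau M X Z sW \<delta> \<eta>A \<longlonglongrightarrow> tauA"
    and worstA: "\<And>\<tau>. amp_fixed_point M X Z sW \<delta> \<eta> \<tau> \<Longrightarrow> \<tau> \<le> tauA"
  shows "\<exists>tauC.
      (\<forall>p\<in>{1..P}. iter_tendsto (\<lambda>s. {..kh s}) (cmp_tau M X Z sW P \<delta>p kh \<eta>C p) tauC) \<and>
      amp_fixed_point M X Z sW \<delta> \<eta> tauC \<and>
      amp_fixed_point M X Z sW \<delta> \<eta> tauA \<and>
      (\<exists>perfC perfA.
        iter_tendsto (\<lambda>s. {..<kh s}) (cmp_avg_mse M X Z sW \<delta> P \<delta>p kh \<eta>C) perfC \<and>
        (\<forall>p\<in>{1..P}. iter_tendsto (\<lambda>s. {..<kh s}) (cmp_mse M X Z sW P \<delta>p kh \<eta>C p) perfC) \<and>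
        amp_mse M X Z sW \<delta> \<eta>A \<longlonglongrightarrow> perfA \<and>
        tauC \<le> tauA \<and> perfC \<le> perfA \<and>
        ((\<exists>!\<tau>. amp_fixed_point M X Z sW \<delta> \<eta> \<tau>) \<longrightarrow> tauC = tauA \<and> perfC = perfA))"
proof -
  interpret prob_space M by (rule M)
  note X_meas = indep_var_rv1[OF indep] and Z_meas = indep_var_rv2[OF indep]
  note mse_lim = tendsto_mse[OF M X_meas Z_meas X2 integrable_std_normal_square[OF Z]]
  define sC where "sC = cmp_sigma2 M X Z sW P \<delta>p kh \<eta>C"
  define tC where "tC = cmp_tau M X Z sW P \<delta>p kh \<eta>C"
  define tauC where "tauC = sqrt (sW\<^sup>2 + (\<Sum>p=1..P. sigC p))"
  have "0 < (\<Sum>p=1..P. 1 / \<delta>p p)"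
    using P \<delta>p by (intro sum_pos) auto
  then have \<delta>_pos: "0 < \<delta>" using \<delta> by simp

  have tau_sel: "(\<lambda>s. tC p s (k s)) \<longlonglongrightarrow> tauC"
    if p: "p \<in> {1..P}" and k: "\<And>s. 1 \<le> s \<Longrightarrow> k s \<in> {..kh s}" for p k
  proof -
    have "(\<lambda>s. tC p s (k s))
        \<longlonglongrightarrow> sqrt (sW\<^sup>2 + (\<Sum>u\<in>{1..P} - {p}. sigC u) + sigC p)"
      unfolding tC_def cmp_tau_def
    proof (intro tendsto_intros)
      show "(\<lambda>s. cmp_sigma2 M X Z sW P \<delta>p kh \<eta>C u s 0) \<longlonglongrightarrow> sigC u"
        if "u \<in> {1..P} - {p}" for u
        using that by (intro iter_tendstoD[OF convC]) auto
      show "(\<lambda>s. cmp_sigma2 M X Z sW P \<delta>p kh \<eta>C p s (k s)) \<longlonglongrightarrow> sigC p"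
        using k by (intro iter_tendstoD[OF convC[OF p]]) auto
    qed
    \<comment> \<open>The processor's own term fills the gap left in the sum over the others, so the
      limit does not depend on \<open>p\<close>.\<close>
    moreover have "(\<Sum>u\<in>{1..P} - {p}. sigC u) + sigC p = (\<Sum>u=1..P. sigC u)"
      using sum.remove[OF _ p, of sigC] by simp
    ultimately show ?thesis by (simp add: tauC_def add.assoc)
  qed
  have mse_sel: "(\<lambda>s. cmp_mse M X Z sW P \<delta>p kh \<eta>C p s (k s)) \<longlonglongrightarrow> mse M X Z \<eta> tauC"
    if p: "p \<in> {1..P}" and k: "\<And>s. 1 \<le> s \<Longrightarrow> k s \<in> {..<kh s}" for p k
  proof -
    \<comment> \<open>The shift to \<open>Suc s\<close> skips row 0: \<open>lipC\<close> covers only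
      \<open>1 \<le> s\<close>, whereas \<open>mse_lim\<close> wants a Lipschitz bound at every
      index.\<close>
    have "(\<lambda>s. mse M X Z (\<eta>C (Suc s) (k (Suc s))) (tC p (Suc s) (k (Suc s))))
        \<longlonglongrightarrow> mse M X Z \<eta> tauC"
    proof (rule mse_lim)
      show "L-lipschitz_on UNIV (\<eta>C (Suc s) (k (Suc s)))" for s
        using k[of "Suc s"] by (intro lipC) auto
      show "(\<lambda>s. \<eta>C (Suc s) (k (Suc s)) x) \<longlonglongrightarrow> \<eta> x" for x
        by (rule LIMSEQ_Suc, rule iter_tendstoD[OF limC]) (rule k)
      show "(\<lambda>s. tC p (Suc s) (k (Suc s))) \<longlonglongrightarrow> tauC"
        by (rule LIMSEQ_Suc, rule tau_sel[OF p]) (use k less_imp_le in auto)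
    qed
    then show ?thesis
      unfolding cmp_mse_def tC_def by (rule LIMSEQ_imp_Suc)
  qed

  \<comment> \<open>The entry at inner index 1 has two limits: \<open>sigC p\<close> by
    \<open>convC\<close>, and the right-hand side by the recursion from inner index 0. Index 1 is in
    range because \<open>1 \<le> kh s\<close>.\<close>
  have sigC_eq: "sigC p = 1 / \<delta>p p * mse M X Z \<eta> tauC" if p: "p \<in> {1..P}" for p
  proof (rule LIMSEQ_unique)
    have "(\<lambda>s. sC p s 1) \<longlonglongrightarrow> sigC p"
      unfolding sC_def using kh by (intro iter_tendstoD[OF convC[OF p]]) auto
    then show "(\<lambda>s. sC p (Suc s) 1) \<longlonglongrightarrow> sigC p" by (rule LIMSEQ_Suc)
    have "(\<lambda>s. cmp_mse M X Z sW P \<delta>p kh \<eta>C p s 0) \<longlonglongrightarrow> mse M X Z \<eta> tauC"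
      by (rule mse_sel[OF p]) (use kh in force)
    then have "(\<lambda>s. 1 / \<delta>p p * cmp_mse M X Z sW P \<delta>p kh \<eta>C p (Suc s) 0)
        \<longlonglongrightarrow> 1 / \<delta>p p * mse M X Z \<eta> tauC"
      by (intro tendsto_mult_left LIMSEQ_Suc)
    then show "(\<lambda>s. sC p (Suc s) 1) \<longlonglongrightarrow> 1 / \<delta>p p * mse M X Z \<eta> tauC"
      by (simp add: sC_def cmp_mse_def cmp_tau_def)
  qed
  have sum_sigC: "(\<Sum>p=1..P. sigC p) = 1 / \<delta> * mse M X Z \<eta> tauC"
    by (simp add: sigC_eq sum_distrib_right flip: \<delta>)
  have fixC: "amp_fixed_point M X Z sW \<delta> \<eta> tauC"
  proof -
    \<comment> \<open>Without nonnegativity of the radicand, squaring \<open>tauC\<close> would not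
      undo the square root.\<close>
    have "0 \<le> sW\<^sup>2 + (\<Sum>p=1..P. sigC p)"
      unfolding sum_sigC using \<delta>_pos by (simp add: mse_nonneg)
    then have "0 \<le> tauC" "tauC\<^sup>2 = sW\<^sup>2 + (\<Sum>p=1..P. sigC p)"
      by (simp_all add: tauC_def)
    then show ?thesis unfolding amp_fixed_point_def sum_sigC by blast
  qed

  have mseA: "amp_mse M X Z sW \<delta> \<eta>A \<longlonglongrightarrow> mse M X Z \<eta> tauA"
    unfolding amp_mse_def by (rule mse_lim[OF lipA limA convA])
  have ampA_nonneg: "0 \<le> amp_sigma2 M X Z sW \<delta> \<eta>A t" for t
    using \<delta>_pos by (cases t) (auto simp: mse_nonneg)
  have fixA: "amp_fixed_point M X Z sW \<delta> \<eta> tauA"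
    unfolding amp_fixed_point_def
  proof
    show "0 \<le> tauA"
      by (rule LIMSEQ_le_const[OF convA]) (auto simp: amp_tau_def ampA_nonneg)
    \<comment> \<open>The squared noise level at \<open>Suc t\<close> is affine in the error at
      \<open>t\<close>, and the shift leaves the limit unchanged, so comparing limits gives the
      fixed point equation.\<close>
    have "(\<lambda>t. (amp_tau M X Z sW \<delta> \<eta>A (Suc t))\<^sup>2) \<longlonglongrightarrow> tauA\<^sup>2"
      by (intro tendsto_power LIMSEQ_Suc convA)
    moreover have "(amp_tau M X Z sW \<delta> \<eta>A (Suc t))\<^sup>2
        = sW\<^sup>2 + 1 / \<delta> * amp_mse M X Z sW \<delta> \<eta>A t" for t
      using ampA_nonneg[of "Suc t"] by (simp add: amp_tau_def amp_mse_def)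
    moreover have "(\<lambda>t. sW\<^sup>2 + 1 / \<delta> * amp_mse M X Z sW \<delta> \<eta>A t)
        \<longlonglongrightarrow> sW\<^sup>2 + 1 / \<delta> * mse M X Z \<eta> tauA"
      by (intro tendsto_intros mseA)
    ultimately show "tauA\<^sup>2 = sW\<^sup>2 + 1 / \<delta> * mse M X Z \<eta> tauA"
      using LIMSEQ_unique by simp
  qed

  \<comment> \<open>Here the known fact that AMP ends at its worst fixed point enters, applied to
    the fixed point reached by C-MP-AMP.\<close>
  have le: "tauC \<le> tauA" by (rule worstA[OF fixC])
  \<comment> \<open>No monotonicity of the error in \<tau> is invoked: at a fixed point the error is
    an increasing affine function of the squared noise level, as \<open>\<delta>\<close> is
    positive.\<close>
  have "tauC\<^sup>2 \<le> tauA\<^sup>2"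
    using le fixC by (intro power_mono) (auto simp: amp_fixed_point_def)
  then have perf_le: "mse M X Z \<eta> tauC \<le> mse M X Z \<eta> tauA"
    using fixC fixA \<delta>_pos by (simp add: amp_fixed_point_def divide_le_cancel)

  have tau_lim: "iter_tendsto (\<lambda>s. {..kh s}) (tC p) tauC" if "p \<in> {1..P}" for p
    using tau_sel[OF that] by (intro iter_tendstoI) auto
  have nonempty: "{..<kh s} \<noteq> {}" if "1 \<le> s" for s
    using kh[OF that] by (auto simp: lessThan_empty_iff)
  have mse_lim_C: "iter_tendsto (\<lambda>s. {..<kh s}) (cmp_mse M X Z sW P \<delta>p kh \<eta>C p) (mse M X Z \<eta> tauC)"
    if "p \<in> {1..P}" for p
    by (rule iter_tendstoI[OF nonempty mse_sel[OF that]])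
  have avg_lim: "iter_tendsto (\<lambda>s. {..<kh s}) (cmp_avg_mse M X Z sW \<delta> P \<delta>p kh \<eta>C)
      (mse M X Z \<eta> tauC)"
  proof (rule iter_tendstoI[OF nonempty])
    fix k :: "nat \<Rightarrow> nat"
    assume k: "\<And>s. 1 \<le> s \<Longrightarrow> k s \<in> {..<kh s}"
    have "(\<lambda>s. cmp_avg_mse M X Z sW \<delta> P \<delta>p kh \<eta>C s (k s))
        \<longlonglongrightarrow> (\<Sum>p=1..P. \<delta> / \<delta>p p * mse M X Z \<eta> tauC)"
      unfolding cmp_avg_mse_def
      by (intro tendsto_sum tendsto_mult_left mse_sel) (use k in auto)
    \<comment> \<open>By \<open>\<delta>\<close> the weights \<open>\<delta> / \<delta>p p\<close>
      sum to 1, so averaging keeps the common limit.\<close>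
    moreover have "(\<Sum>p=1..P. \<delta> / \<delta>p p * mse M X Z \<eta> tauC) = \<delta> * (\<Sum>p=1..P. 1 / \<delta>p p) * mse M X Z \<eta> tauC"
      by (simp add: sum_distrib_left sum_distrib_right)
    ultimately show "(\<lambda>s. cmp_avg_mse M X Z sW \<delta> P \<delta>p kh \<eta>C s (k s)) \<longlonglongrightarrow> mse M X Z \<eta> tauC"
      using \<delta> \<delta>_pos by simp
  qed

  have unique: "tauC = tauA" if "\<exists>!\<tau>. amp_fixed_point M X Z sW \<delta> \<eta> \<tau>"
    using that fixC fixA by blast
  show ?thesis
    using tau_lim[unfolded tC_def] fixC fixA avg_lim mse_lim_C mseA le perf_le unique
    by (intro exI[of _ tauC] exI[of _ "mse M X Z \<eta> tauC"] exI[of _ "mse M X Z \<eta> tauA"] conjI)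
      auto
qed

end
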